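(* Let $p=(12,R)$ be the mesh pattern with $R=\{(0,1),(0,2),(1,0),(1,1),(1,2),(2,0),(2,1)\}$. Let $F(x)=\sum_{n\ge0}n!\,x^n$, $F(x,q)=\sum_{n\ge 0}x^n\sum_{\pi\in S_n}q^{p(\pi)}$, and $A(x)=\sum_{n\ge0}|S_n(p)|x^n$. Then, as formal power series in $x$, $$A(x)=\frac{(1+x)F(x)}{1+x+x^2F(x)},\qquad F(x,q)=\frac{(1+x-qx)F(x)}{1+(1-q)x+(1-q)x^2F(x)}.$$
   Context: $S_n$ is the set of permutations $\pi=\pi_1\cdots\pi_n$ of $\{1,\dots,n\}$ ($S_0$ contains only the empty permutation). A mesh pattern $(12,R)$ consists of the permutation $12$ and a set $R\subseteq\{0,1,2\}\times\{0,1,2\}$ of shaded boxes. An occurrence of $(12,R)$ in $\pi\in S_n$ is a pair of positions $s<t$ with $\pi_s<\pi_t$ such that, putting $s_0=0,\ s_1=s,\ s_2=t,\ s_3=n+1$ and $v_0=0,\ v_1=\pi_s,\ v_2=\pi_t,\ v_3=n+1$, for every $(i,j)\in R$ there is no position $m$ with $s_i<m<s_{i+1}$ and $v_j<\pi_m<v_{j+1}$. $p(\pi)$ is the number of occurrences of $p$ in $\pi$, and $S_n(p)$ is the set of $\pi\in S_n$ with $p(\pi)=0$ (permutations avoiding $p$). *)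

theory Defs
  imports "HOL-Computational_Algebra.Computational_Algebra" "HOL-Combinatorics.Permutations"
begin

(* A permutation pi in S_n is a function on nat with "pi permutes {1..n}"; outside {1..n} it is
   the identity, so that S_0 = {id}. *)
definition Sn :: "nat \<Rightarrow> (nat \<Rightarrow> nat) set" where
  "Sn n = {\<pi>. \<pi> permutes {1..n}}"

(* The lists are s_0,...,s_3 and v_0,...,v_3. *)
definition mesh12_occs :: "(nat \<times> nat) set \<Rightarrow> nat \<Rightarrow> (nat \<Rightarrow> nat) \<Rightarrow> (nat \<times> nat) set" where
  "mesh12_occs R n \<pi> =
     {(s, t). s \<in> {1..n} \<and> t \<in> {1..n} \<and> s < t \<and> \<pi> s < \<pi> t \<and>
        (let ss = [0, s, t, n + 1]; vs = [0, \<pi> s, \<pi> t, n + 1] in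
          \<forall>(i, j) \<in> R. \<not> (\<exists>m \<in> {1..n}.
             ss ! i < m \<and> m < ss ! (i + 1) \<and> vs ! j < \<pi> m \<and> \<pi> m < vs ! (j + 1)))}"

definition mesh12_count :: "(nat \<times> nat) set \<Rightarrow> nat \<Rightarrow> (nat \<Rightarrow> nat) \<Rightarrow> nat" where
  "mesh12_count R n \<pi> = card (mesh12_occs R n \<pi>)"

definition Sn_avoid :: "(nat \<times> nat) set \<Rightarrow> nat \<Rightarrow> (nat \<Rightarrow> nat) set" where
  "Sn_avoid R n = {\<pi> \<in> Sn n. mesh12_count R n \<pi> = 0}"

definition fact_gf :: "'a :: semiring_char_0 fps" where
  "fact_gf = Abs_fps (\<lambda>n. fact n)"

definition avoid_gf :: "(nat \<times> nat) set \<Rightarrow> rat fps" where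
  "avoid_gf R = Abs_fps (\<lambda>n. of_nat (card (Sn_avoid R n)))"

(* The polynomial in the indeterminate q = monom 1 1. *)
definition mesh12_poly :: "(nat \<times> nat) set \<Rightarrow> nat \<Rightarrow> int poly" where
  "mesh12_poly R n = (\<Sum>\<pi> \<in> Sn n. monom 1 (mesh12_count R n \<pi>))"

(* Division of formal power series needs coefficients in a field, so Z[q] is embedded in its
   field of fractions Q(q). *)
definition of_qpoly :: "int poly \<Rightarrow> int poly fract" where
  "of_qpoly f = Fraction_Field.Fract f 1"

definition distr_gf :: "(nat \<times> nat) set \<Rightarrow> int poly fract fps" where
  "distr_gf R = Abs_fps (\<lambda>n. of_qpoly (mesh12_poly R n))"

definition fps_q :: "int poly fract fps" where
  "fps_q = fps_const (of_qpoly (monom 1 1))"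

definition shaded :: "(nat \<times> nat) set" where
  "shaded = {(0,1), (0,2), (1,0), (1,1), (1,2), (2,0), (2,1)}"

end

theory Submission
  imports Defs
begin

text \<open>
The two unshaded boxes are the lower left and the upper right one. An occurrence therefore consists
of two neighbouring entries with neighbouring values such that every earlier entry is smaller and
every later entry is larger: it is a decomposition $\pi = \sigma \oplus 1 \oplus 1 \oplus \tau$.
Call $c$ a cut of $\pi$ if $\pi$ maps the first $c$ positions to themselves; occurrences correspond
to triples $c, c+1, c+2$ of consecutive cuts (\<open>occs_shaded_eq\<close>).

Let $P$ be the series of all permutations weighted by $q$ to the number of occurrences, and write
$u = q - 1$. The identity $q^m - 1 = u (1 + q + \dots + q^{m-1})$, read as a sum over the $m$
occurrences where each one is weighted by $q$ to the number of occurrences to its right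
(\<open>power_card_minus_one\<close>), turns $P - F$ into $u$ times a sum over permutations
$\sigma \oplus 1 \oplus 1 \oplus \tau$ with one marked occurrence. The part $\sigma$ is arbitrary
and unweighted, and the occurrences to the right of the marked one are those of $1 \oplus \tau$.
If $Q$ is the series of all $\tau$ weighted by the occurrences in $1 \oplus \tau$, this says
$P - F = u x^2 F Q$ (\<open>weight_sum_rec\<close>). Prepending $1$ to $\tau$ creates one new occurrence
exactly if $\tau$ itself begins with $1$, hence $Q = P + u x Q$ (\<open>fixed_point_weight_sum_Suc\<close>).
Eliminating $Q$ yields $P (1 - u x - u x^2 F) = (1 - u x) F$, the claimed formula for $F(x,q)$.

The recurrences hold for $q$ in any commutative ring. The distribution is the case of the
indeterminate $q$, and avoidance is the case $q = 0$.
\<close>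

section \<open>Cuts of a permutation\<close>

text \<open>
Including the position $0$, which permutations in \<open>Sn n\<close> fix, makes $0$ a cut. Every $c \ge n$
satisfies this predicate as well, so sets of cuts need an explicit upper bound.
\<close>
definition is_cut :: "(nat \<Rightarrow> nat) \<Rightarrow> nat \<Rightarrow> bool" where
  "is_cut \<pi> c \<longleftrightarrow> (\<forall>m\<le>c. \<pi> m \<le> c)"

definition triple_cuts :: "nat \<Rightarrow> (nat \<Rightarrow> nat) \<Rightarrow> nat set" where
  "triple_cuts n \<pi> = {c. c + 2 \<le> n \<and> is_cut \<pi> c \<and> is_cut \<pi> (c + 1) \<and> is_cut \<pi> (c + 2)}"

lemma finite_triple_cuts [simp]: "finite (triple_cuts n \<pi>)"
  by (rule finite_subset[of _ "{..n}"]) (auto simp: triple_cuts_def)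

lemma finite_Sn [simp]: "finite (Sn n)"
  by (simp add: Sn_def finite_permutations)

lemma card_Sn [simp]: "card (Sn n) = fact n"
  by (simp add: Sn_def card_permutations)

lemma Sn_iff: "\<pi> \<in> Sn n \<longleftrightarrow> bij \<pi> \<and> \<pi> 0 = 0 \<and> (\<forall>m>n. \<pi> m = m)"
proof
  assume "\<pi> \<in> Sn n"
  then show "bij \<pi> \<and> \<pi> 0 = 0 \<and> (\<forall>m>n. \<pi> m = m)"
    by (auto simp: Sn_def permutes_bij permutes_not_in)
next
  assume *: "bij \<pi> \<and> \<pi> 0 = 0 \<and> (\<forall>m>n. \<pi> m = m)"
  then have "\<pi> m = m" if "m \<notin> {1..n}" for m
    using that by (cases "m = 0") auto
  with * show "\<pi> \<in> Sn n"
    by (auto simp: Sn_def permutes_def bij_iff)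
qed

lemma Sn_in_range: "\<pi> \<in> Sn n \<Longrightarrow> m \<in> {1..n} \<Longrightarrow> \<pi> m \<in> {1..n}"
  by (simp only: Sn_def mem_Collect_eq permutes_in_image)

lemma Sn_cut:
  assumes "\<pi> \<in> Sn n" "n \<le> c"
  shows "is_cut \<pi> c"
  unfolding is_cut_def
proof (intro allI impI)
  fix m assume "m \<le> c"
  then show "\<pi> m \<le> c"
    using Sn_in_range[OF assms(1), of m] assms
    by (cases "m = 0 \<or> n < m") (auto simp: Sn_iff)
qed

lemma is_cut_Suc: "is_cut \<pi> c \<Longrightarrow> \<pi> (Suc c) = Suc c \<Longrightarrow> is_cut \<pi> (Suc c)"
  by (auto simp: is_cut_def le_Suc_eq)

lemma cut_0 [simp]: "\<pi> \<in> Sn n \<Longrightarrow> is_cut \<pi> 0"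
  by (simp add: is_cut_def Sn_iff)

text \<open>
An injective self-map of the finite set of positions up to $c$ is onto, so nothing from beyond a
cut can land below it.
\<close>
lemma cut_le_iff:
  assumes "inj \<pi>" "is_cut \<pi> c"
  shows "\<pi> m \<le> c \<longleftrightarrow> m \<le> c"
proof -
  have "\<pi> ` {..c} = {..c}"
    using assms by (intro endo_inj_surj) (auto simp: is_cut_def intro: inj_on_subset)
  then show ?thesis
    using assms by (metis atMost_iff inj_image_mem_iff)
qed

text \<open>
The entries before position $s$ are exactly those with value below $\pi_s$; comparing the
cardinalities of the two sets gives the value.
\<close>
lemma strong_fixed_point:
  fixes \<pi> :: "nat \<Rightarrow> nat"
  assumes "bij \<pi>" "\<And>m. m < s \<Longrightarrow> \<pi> m < \<pi> s" "\<And>m. s < m \<Longrightarrow> \<pi> s < \<pi> m"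
  shows "\<pi> s = s"
proof -
  have "y \<in> \<pi> ` {..<s}" if "y < \<pi> s" for y
  proof -
    obtain m where "y = \<pi> m" using assms(1) by (metis bij_pointE)
    with that assms(3)[of m] show ?thesis
      by (cases m s rule: linorder_cases) auto
  qed
  with assms(2) have "\<pi> ` {..<s} = {..<\<pi> s}" by auto
  moreover have "card (\<pi> ` {..<s}) = s"
    using assms(1) by (subst card_image) (auto simp: bij_def intro: inj_on_subset)
  ultimately show ?thesis by simp
qed

section \<open>Occurrences as triples of consecutive cuts\<close>

lemma ball_shaded:
  "(\<forall>(i, j) \<in> shaded. P i j) \<longleftrightarrow>
     P 0 1 \<and> P 0 2 \<and> P 1 0 \<and> P 1 1 \<and> P 1 2 \<and> P 2 0 \<and> P 2 1"
  by (auto simp: shaded_def)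

text \<open>
The box conditions stated for one entry $m$ at a time. The outer boundaries $0$ and $n+1$ of the
boxes disappear, since every entry lies between them.
\<close>
lemma occs_shaded_iff:
  assumes "\<pi> \<in> Sn n"
  shows "(s, t) \<in> mesh12_occs shaded n \<pi> \<longleftrightarrow>
    1 \<le> s \<and> s < t \<and> t \<le> n \<and> \<pi> s < \<pi> t \<and>
    (\<forall>m\<in>{1..n}.
       (m < s \<longrightarrow> \<not> (\<pi> s < \<pi> m \<and> \<pi> m < \<pi> t) \<and> \<not> \<pi> t < \<pi> m) \<and>
       (s < m \<and> m < t \<longrightarrow> \<not> \<pi> m < \<pi> s \<and> \<not> (\<pi> s < \<pi> m \<and> \<pi> m < \<pi> t) \<and> \<not> \<pi> t < \<pi> m) \<and>
       (t < m \<longrightarrow> \<not> \<pi> m < \<pi> s \<and> \<not> (\<pi> s < \<pi> m \<and> \<pi> m < \<pi> t)))"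
    (is "_ \<longleftrightarrow> 1 \<le> s \<and> s < t \<and> t \<le> n \<and> \<pi> s < \<pi> t \<and> (\<forall>m\<in>_. ?boxes m)")
proof -
  define Q where "Q i j m \<longleftrightarrow>
    [0, s, t, n + 1] ! i < m \<and> m < [0, s, t, n + 1] ! (i + 1) \<and>
    [0, \<pi> s, \<pi> t, n + 1] ! j < \<pi> m \<and> \<pi> m < [0, \<pi> s, \<pi> t, n + 1] ! (j + 1)" for i j m
  have "(\<forall>(i, j)\<in>shaded. \<not> (\<exists>m\<in>{1..n}. Q i j m)) \<longleftrightarrow>
      (\<forall>m\<in>{1..n}. \<forall>(i, j)\<in>shaded. \<not> Q i j m)"
    by blast
  also have "\<dots> \<longleftrightarrow> (\<forall>m\<in>{1..n}. ?boxes m)"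
  proof (intro ball_cong refl)
    fix m assume m: "m \<in> {1..n}"
    then have "0 < m" "m < n + 1" "0 < \<pi> m" "\<pi> m < n + 1"
      using Sn_in_range[OF assms m] by auto
    then show "(\<forall>(i, j)\<in>shaded. \<not> Q i j m) \<longleftrightarrow> ?boxes m"
      unfolding ball_shaded Q_def by (simp add: numeral_2_eq_2) argo
  qed
  finally have boxes: "(\<forall>(i, j)\<in>shaded. \<not> (\<exists>m\<in>{1..n}. Q i j m)) \<longleftrightarrow>
      (\<forall>m\<in>{1..n}. ?boxes m)" .
  have "(s, t) \<in> mesh12_occs shaded n \<pi> \<longleftrightarrow>
      s \<in> {1..n} \<and> t \<in> {1..n} \<and> s < t \<and> \<pi> s < \<pi> t \<and>
      (\<forall>(i, j)\<in>shaded. \<not> (\<exists>m\<in>{1..n}. Q i j m))"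
    by (simp only: mesh12_occs_def Let_def Q_def mem_Collect_eq case_prod_conv)
  moreover have "s \<in> {1..n} \<and> t \<in> {1..n} \<and> s < t \<and> B \<longleftrightarrow> 1 \<le> s \<and> s < t \<and> t \<le> n \<and> B" for B
    by auto
  ultimately show ?thesis
    by (simp only: boxes)
qed

text \<open>
Column $1$ is shaded, so the two positions of an occurrence are neighbours. The remaining shaded
boxes force earlier entries below both values and later entries above both, so both are fixed points
and the positions before, between and after them are cuts.
\<close>
lemma occs_shaded_eq:
  assumes "\<pi> \<in> Sn n"
  shows "mesh12_occs shaded n \<pi> = (\<lambda>c. (c + 1, c + 2)) ` triple_cuts n \<pi>"
proof (intro equalityI subsetI)
  have bij: "bij \<pi>" and inj: "inj \<pi>" and pi0: "\<pi> 0 = 0" and big: "\<And>m. m > n \<Longrightarrow> \<pi> m = m"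
    using assms by (auto simp: Sn_iff bij_def)
  have inS: "1 \<le> \<pi> m \<and> \<pi> m \<le> n" if "1 \<le> m" "m \<le> n" for m
    using Sn_in_range[OF assms, of m] that by simp
  {
    fix x assume "x \<in> mesh12_occs shaded n \<pi>"
    then obtain s t where x: "x = (s, t)" and occ: "(s, t) \<in> mesh12_occs shaded n \<pi>"
      by (cases x) auto
    note occ = occ[unfolded occs_shaded_iff[OF assms]]
    have st: "1 \<le> s" "s < t" "t \<le> n" "\<pi> s < \<pi> t"
      and box: "\<And>m. m \<in> {1..n} \<Longrightarrow>
        (m < s \<longrightarrow> \<not> (\<pi> s < \<pi> m \<and> \<pi> m < \<pi> t) \<and> \<not> \<pi> t < \<pi> m) \<and>
        (s < m \<and> m < t \<longrightarrow> \<not> \<pi> m < \<pi> s \<and> \<not> (\<pi> s < \<pi> m \<and> \<pi> m < \<pi> t) \<and> \<not> \<pi> t < \<pi> m) \<and>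
        (t < m \<longrightarrow> \<not> \<pi> m < \<pi> s \<and> \<not> (\<pi> s < \<pi> m \<and> \<pi> m < \<pi> t))"
      using occ by auto
    have ne: "\<pi> m = \<pi> k \<longleftrightarrow> m = k" for m k
      using inj by (simp add: inj_eq)
    have adj: "t = s + 1"
      using box[of "s + 1"] st ne[of "s + 1" s] ne[of "s + 1" t]
      by (cases "s + 1 = t") auto
    have below: "\<pi> m < \<pi> s" if "m < s" for m
    proof (cases "m = 0")
      case True then show ?thesis using inS[of s] st pi0 by simp
    next
      case False
      then show ?thesis using box[of m] that st ne[of m s] ne[of m t] by auto
    qed
    have above: "\<pi> t < \<pi> m" if "t < m" for m
    proof (cases "m \<le> n")
      case True
      then show ?thesis using box[of m] that st ne[of m s] ne[of m t] by auto
    next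
      case False
      then show ?thesis using big[of m] inS[of t] st by simp
    qed
    have "\<pi> s = s"
      using bij below above adj st
      by (intro strong_fixed_point) (auto, metis Suc_lessI less_trans)
    moreover have "\<pi> t = t"
      using bij below above adj st
      by (intro strong_fixed_point) (auto, metis less_antisym less_trans)
    moreover obtain c where c: "s = Suc c" using st(1) by (cases s) auto
    moreover have "is_cut \<pi> c"
      using below c \<open>\<pi> s = s\<close> by (simp add: is_cut_def less_Suc_eq_le)
    ultimately have "c \<in> triple_cuts n \<pi>"
      using st(3) adj is_cut_Suc[of \<pi> c] is_cut_Suc[of \<pi> "Suc c"] by (simp add: triple_cuts_def)
    then show "x \<in> (\<lambda>c. (c + 1, c + 2)) ` triple_cuts n \<pi>"
      using x c adj by simp
  }
  {
    fix x assume "x \<in> (\<lambda>c. (c + 1, c + 2)) ` triple_cuts n \<pi>"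
    then obtain c where x: "x = (c + 1, c + 2)" and c: "c + 2 \<le> n"
      "is_cut \<pi> c" "is_cut \<pi> (c + 1)" "is_cut \<pi> (c + 2)"
      by (auto simp: triple_cuts_def)
    note le = cut_le_iff[OF inj c(2)] cut_le_iff[OF inj c(3)] cut_le_iff[OF inj c(4)]
    have fixed: "\<pi> (c + 1) = c + 1" "\<pi> (c + 2) = c + 2"
      using le[of "c + 1"] le[of "c + 2"] by auto
    have below: "\<pi> m < c + 1" if "m < c + 1" for m
      using le(1)[of m] that by simp
    have above: "c + 2 < \<pi> m" if "c + 2 < m" for m
      using le(3)[of m] that by (simp add: not_le[symmetric])
    show "x \<in> mesh12_occs shaded n \<pi>"
      unfolding x occs_shaded_iff[OF assms] fixed
    proof (intro conjI)
      show "\<forall>m\<in>{1..n}.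
        (m < c + 1 \<longrightarrow> \<not> (c + 1 < \<pi> m \<and> \<pi> m < c + 2) \<and> \<not> c + 2 < \<pi> m) \<and>
        (c + 1 < m \<and> m < c + 2 \<longrightarrow> \<not> \<pi> m < c + 1 \<and>
          \<not> (c + 1 < \<pi> m \<and> \<pi> m < c + 2) \<and> \<not> c + 2 < \<pi> m) \<and>
        (c + 2 < m \<longrightarrow> \<not> \<pi> m < c + 1 \<and> \<not> (c + 1 < \<pi> m \<and> \<pi> m < c + 2))"
        (is "\<forall>m\<in>_. ?boxes m")
      proof
        fix m
        consider "m < c + 1" | "m = c + 1" | "m = c + 2" | "c + 2 < m" by linarith
        then show "?boxes m"
          by cases (use below[of m] above[of m] in simp_all)
      qed
    qed (use c(1) in simp_all)
  }
qed

lemma mesh12_count_shaded: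
  "\<pi> \<in> Sn n \<Longrightarrow> mesh12_count shaded n \<pi> = card (triple_cuts n \<pi>)"
  unfolding mesh12_count_def by (simp add: occs_shaded_eq card_image inj_on_def)

section \<open>Direct sums\<close>

text \<open>
The direct sum $\sigma \oplus \tau$ with $\sigma$ of size $a$. The size of $\tau$ does not enter,
because $\tau$ fixes all larger positions.
\<close>
definition dsum :: "nat \<Rightarrow> (nat \<Rightarrow> nat) \<Rightarrow> (nat \<Rightarrow> nat) \<Rightarrow> nat \<Rightarrow> nat" where
  "dsum a \<sigma> \<tau> m = (if m \<le> a then \<sigma> m else a + \<tau> (m - a))"

lemma dsum_cut_shift:
  assumes "\<sigma> \<in> Sn a" "\<tau> \<in> Sn k"
  shows "is_cut (dsum a \<sigma> \<tau>) (a + d) \<longleftrightarrow> is_cut \<tau> d"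
proof
  assume *: "is_cut (dsum a \<sigma> \<tau>) (a + d)"
  show "is_cut \<tau> d"
    unfolding is_cut_def
  proof (intro allI impI)
    fix m assume "m \<le> d"
    with *[unfolded is_cut_def, rule_format, of "a + m"] assms show "\<tau> m \<le> d"
      by (cases "m = 0") (auto simp: dsum_def Sn_iff)
  qed
next
  assume "is_cut \<tau> d"
  then show "is_cut (dsum a \<sigma> \<tau>) (a + d)"
    using Sn_cut[OF assms(1) order.refl] by (auto simp: is_cut_def dsum_def trans_le_add1)
qed

lemma dsum_in_Sn:
  assumes "\<sigma> \<in> Sn a" "\<tau> \<in> Sn k"
  shows "dsum a \<sigma> \<tau> \<in> Sn (a + k)"
proof -
  have s: "bij \<sigma>" "is_cut \<sigma> a" "\<sigma> 0 = 0" and t: "bij \<tau>" "\<tau> 0 = 0" "\<And>m. m > k \<Longrightarrow> \<tau> m = m"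
    using assms by (auto simp: Sn_iff Sn_cut)
  have le: "\<sigma> m \<le> a \<longleftrightarrow> m \<le> a" for m
    using s cut_le_iff bij_def by metis
  have t0: "\<tau> m = 0 \<longleftrightarrow> m = 0" for m
    using t by (metis bij_pointE)
  have "inj (dsum a \<sigma> \<tau>)"
  proof (rule injI)
    fix x y assume *: "dsum a \<sigma> \<tau> x = dsum a \<sigma> \<tau> y"
    have gt: "a < a + \<tau> (m - a)" if "\<not> m \<le> a" for m
      using that t0[of "m - a"] by auto
    show "x = y"
      using * gt[of x] gt[of y] le[of x] le[of y] s(1) t(1)
      by (auto simp: dsum_def bij_def inj_eq split: if_splits)
  qed
  moreover have "y \<in> range (dsum a \<sigma> \<tau>)" for y
  proof (cases "y \<le> a")
    case True
    obtain m where "y = \<sigma> m" using s by (metis bij_pointE)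
    then show ?thesis using True le by (intro image_eqI[of _ _ m]) (auto simp: dsum_def)
  next
    case False
    obtain m where m: "y - a = \<tau> m" using t by (metis bij_pointE)
    then have "m \<noteq> 0" using False t(2) by (intro notI) simp
    then show ?thesis using False m by (intro image_eqI[of _ _ "a + m"]) (auto simp: dsum_def)
  qed
  ultimately show ?thesis
    using s(3) t by (auto simp: Sn_iff bij_def dsum_def)
qed

text \<open>
A permutation with cut $a$ splits uniquely into its restriction to the first $a$ positions and the
shifted rest.
\<close>
lemma dsum_bij:
  "bij_betw (\<lambda>(\<sigma>, \<tau>). dsum a \<sigma> \<tau>) (Sn a \<times> Sn k) {\<pi> \<in> Sn (a + k). is_cut \<pi> a}"
proof (rule bij_betwI')
  fix x y assume "x \<in> Sn a \<times> Sn k" "y \<in> Sn a \<times> Sn k"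
  then obtain \<sigma> \<tau> \<sigma>' \<tau>' where x: "x = (\<sigma>, \<tau>)" "\<sigma> \<in> Sn a" "\<tau> \<in> Sn k"
    and y: "y = (\<sigma>', \<tau>')" "\<sigma>' \<in> Sn a" "\<tau>' \<in> Sn k" by auto
  have "\<sigma> = \<sigma>' \<and> \<tau> = \<tau>'" if *: "dsum a \<sigma> \<tau> = dsum a \<sigma>' \<tau>'"
  proof (intro conjI ext)
    fix m
    show "\<sigma> m = \<sigma>' m"
      using fun_cong[OF *, of m] x y by (cases "m \<le> a") (auto simp: dsum_def Sn_iff)
    show "\<tau> m = \<tau>' m"
      using fun_cong[OF *, of "a + m"] x y by (cases "m = 0") (auto simp: dsum_def Sn_iff)
  qed
  then show "((case x of (\<sigma>, \<tau>) \<Rightarrow> dsum a \<sigma> \<tau>) = (case y of (\<sigma>, \<tau>) \<Rightarrow> dsum a \<sigma> \<tau>)) = (x = y)"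
    using x y by auto
next
  fix x assume "x \<in> Sn a \<times> Sn k"
  then show "(case x of (\<sigma>, \<tau>) \<Rightarrow> dsum a \<sigma> \<tau>) \<in> {\<pi> \<in> Sn (a + k). is_cut \<pi> a}"
    using dsum_cut_shift[of _ a _ k 0] by (auto simp: dsum_in_Sn)
next
  fix \<pi> assume "\<pi> \<in> {\<pi> \<in> Sn (a + k). is_cut \<pi> a}"
  then have pi: "bij \<pi>" "\<pi> 0 = 0" "\<And>m. m > a + k \<Longrightarrow> \<pi> m = m" and icut: "is_cut \<pi> a"
    by (auto simp: Sn_iff)
  have le: "\<pi> m \<le> a \<longleftrightarrow> m \<le> a" for m
    using pi icut cut_le_iff bij_def by metis
  define \<sigma> where "\<sigma> m = (if m \<le> a then \<pi> m else m)" for m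
  define \<tau> where "\<tau> m = (if m = 0 then 0 else \<pi> (a + m) - a)" for m
  have "inj \<sigma>"
  proof (rule injI)
    fix x y assume "\<sigma> x = \<sigma> y"
    then show "x = y"
      using le[of x] le[of y] pi(1) by (auto simp: \<sigma>_def bij_def inj_eq split: if_splits)
  qed
  moreover have "y \<in> range \<sigma>" for y
  proof (cases "y \<le> a")
    case True
    obtain m where m: "y = \<pi> m" using pi by (metis bij_pointE)
    then show ?thesis using True le[of m] by (intro image_eqI[of _ _ m]) (auto simp: \<sigma>_def)
  next
    case False
    then show ?thesis by (intro image_eqI[of _ _ y]) (auto simp: \<sigma>_def)
  qed
  ultimately have \<sigma>: "\<sigma> \<in> Sn a"
    using pi by (auto simp: Sn_iff bij_def \<sigma>_def)
  have "inj \<tau>"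
  proof (rule injI)
    fix x y assume "\<tau> x = \<tau> y"
    then have "x = 0 \<and> y = 0 \<or> \<pi> (a + x) = \<pi> (a + y)"
      using le[of "a + x"] le[of "a + y"] by (simp add: \<tau>_def split: if_splits)
    then show "x = y"
      using pi(1) by (auto simp: bij_def inj_eq)
  qed
  moreover have "y \<in> range \<tau>" for y
  proof (cases "y = 0")
    case True then show ?thesis by (auto simp: \<tau>_def image_iff)
  next
    case False
    obtain m where m: "a + y = \<pi> m" using pi by (metis bij_pointE)
    then have "a < m" using False le[of m] by auto
    then show ?thesis using m[symmetric]
      by (intro image_eqI[of _ _ "m - a"]) (auto simp: \<tau>_def)
  qed
  ultimately have \<tau>: "\<tau> \<in> Sn k"
    using pi by (auto simp: Sn_iff bij_def \<tau>_def)
  have "\<pi> = dsum a \<sigma> \<tau>"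
  proof
    fix m show "\<pi> m = dsum a \<sigma> \<tau> m"
      using le[of m] by (auto simp: dsum_def \<sigma>_def \<tau>_def)
  qed
  then show "\<exists>x\<in>Sn a \<times> Sn k. \<pi> = (case x of (\<sigma>, \<tau>) \<Rightarrow> dsum a \<sigma> \<tau>)"
    using \<sigma> \<tau> by auto
qed

lemma Sn_mono: "\<pi> \<in> Sn a \<Longrightarrow> a \<le> b \<Longrightarrow> \<pi> \<in> Sn b"
  by (auto simp: Sn_iff)

lemma id_in_Sn [simp]: "id \<in> Sn n"
  by (simp add: Sn_iff)

text \<open>
A cut at $n$ leaves only the value $n+1$ for position $n+1$.
\<close>
lemma Sn_step_down:
  assumes "\<pi> \<in> Sn (Suc n)" "is_cut \<pi> n"
  shows "\<pi> \<in> Sn n"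
proof -
  have "\<not> \<pi> (Suc n) \<le> n"
    using assms by (simp add: cut_le_iff Sn_iff bij_def)
  then have "\<pi> (Suc n) = Suc n"
    using Sn_in_range[OF assms(1), of "Suc n"] by simp
  then have "\<pi> m = m" if "n < m" for m
    using assms(1) that by (cases "m = Suc n") (auto simp: Sn_iff)
  with assms(1) show ?thesis by (simp add: Sn_iff)
qed

lemma cut_dsum_left: "d \<le> a \<Longrightarrow> is_cut (dsum a \<sigma> \<tau>) d \<longleftrightarrow> is_cut \<sigma> d"
  by (auto simp: is_cut_def dsum_def)

lemma triple_cuts_dsum:
  assumes "\<sigma> \<in> Sn a" "\<tau> \<in> Sn k"
  shows "{d \<in> triple_cuts (a + k) (dsum a \<sigma> \<tau>). a \<le> d} = (+) a ` triple_cuts k \<tau>"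
proof (intro equalityI subsetI)
  fix d assume d: "d \<in> {d \<in> triple_cuts (a + k) (dsum a \<sigma> \<tau>). a \<le> d}"
  then obtain e where "d = a + e" by (auto simp: le_iff_add)
  with d show "d \<in> (+) a ` triple_cuts k \<tau>"
    using dsum_cut_shift[OF assms, of e] dsum_cut_shift[OF assms, of "e + 1"]
      dsum_cut_shift[OF assms, of "e + 2"]
    by (auto simp: triple_cuts_def add.assoc)
next
  fix d assume "d \<in> (+) a ` triple_cuts k \<tau>"
  then obtain e where "d = a + e" "e \<in> triple_cuts k \<tau>" by auto
  then show "d \<in> {d \<in> triple_cuts (a + k) (dsum a \<sigma> \<tau>). a \<le> d}"
    using dsum_cut_shift[OF assms, of e] dsum_cut_shift[OF assms, of "e + 1"]
      dsum_cut_shift[OF assms, of "e + 2"]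
    by (auto simp: triple_cuts_def add.assoc)
qed

text \<open>
The permutations $\sigma \oplus 1 \oplus 1 \oplus \tau$ with $\sigma$ of size $c$: regarded as a
permutation of $c+2$ positions, $\sigma$ already includes the two fixed points.
\<close>
lemma triple_cut_bij:
  "bij_betw (\<lambda>(\<sigma>, \<tau>). dsum (c + 2) \<sigma> \<tau>) (Sn c \<times> Sn k)
     {\<pi> \<in> Sn (c + 2 + k). c \<in> triple_cuts (c + 2 + k) \<pi>}"
proof (rule bij_betw_subset[OF dsum_bij])
  show "Sn c \<times> Sn k \<subseteq> Sn (c + 2) \<times> Sn k"
    using Sn_mono[of _ c "c + 2"] by auto
  show "(\<lambda>(\<sigma>, \<tau>). dsum (c + 2) \<sigma> \<tau>) ` (Sn c \<times> Sn k) =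
      {\<pi> \<in> Sn (c + 2 + k). c \<in> triple_cuts (c + 2 + k) \<pi>}" (is "?f ` _ = ?R")
  proof (intro equalityI subsetI)
    fix \<pi> assume "\<pi> \<in> ?f ` (Sn c \<times> Sn k)"
    then obtain \<sigma> \<tau> where *: "\<pi> = dsum (c + 2) \<sigma> \<tau>" "\<sigma> \<in> Sn c" "\<tau> \<in> Sn k" by auto
    then have "\<sigma> \<in> Sn (c + 2)" by (auto intro: Sn_mono)
    with * show "\<pi> \<in> ?R"
      using dsum_in_Sn[of \<sigma> "c + 2" \<tau> k]
      by (auto simp: triple_cuts_def cut_dsum_left intro: Sn_cut)
  next
    fix \<pi> assume \<pi>: "\<pi> \<in> ?R"
    then have "\<pi> \<in> ?f ` (Sn (c + 2) \<times> Sn k)"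
      using dsum_bij[of "c + 2" k] by (auto simp: bij_betw_def triple_cuts_def)
    then obtain \<sigma> \<tau> where *: "\<pi> = dsum (c + 2) \<sigma> \<tau>" "\<sigma> \<in> Sn (c + 2)" "\<tau> \<in> Sn k" by auto
    then have "is_cut \<sigma> c" "is_cut \<sigma> (c + 1)"
      using \<pi> by (auto simp: triple_cuts_def cut_dsum_left)
    then have "\<sigma> \<in> Sn c"
      using * Sn_step_down[of \<sigma> "Suc c"] Sn_step_down[of \<sigma> c] by simp
    with * show "\<pi> \<in> ?f ` (Sn c \<times> Sn k)" by auto
  qed
qed

text \<open>
An instance of the associativity of $\oplus$: one of the two fixed points moves from the left summand
to the right one.
\<close>
lemma dsum_fixed_point:
  assumes "\<sigma> \<in> Sn c"
  shows "dsum (c + 2) \<sigma> \<tau> = dsum (c + 1) \<sigma> (dsum 1 id \<tau>)"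
proof
  fix m show "dsum (c + 2) \<sigma> \<tau> m = dsum (c + 1) \<sigma> (dsum 1 id \<tau>) m"
    using assms by (cases "m = c + 2") (auto simp: dsum_def Sn_iff)
qed

text \<open>
A triple of cuts that starts later than $c$ starts at $c+1$ or beyond, so it lies entirely in the
right summand of $(\sigma \oplus 1) \oplus (1 \oplus \tau)$.
\<close>
lemma card_later_triple_cuts:
  assumes "\<sigma> \<in> Sn c" "\<tau> \<in> Sn k"
  shows "card {d \<in> triple_cuts (c + 2 + k) (dsum (c + 2) \<sigma> \<tau>). c < d} =
         card (triple_cuts (Suc k) (dsum 1 id \<tau>))"
proof -
  have "\<sigma> \<in> Sn (c + 1)" using assms by (auto intro: Sn_mono)
  moreover have "dsum 1 id \<tau> \<in> Sn (Suc k)"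
    using dsum_in_Sn[of id 1 \<tau> k] assms by simp
  ultimately have "{d \<in> triple_cuts (c + 1 + Suc k) (dsum (c + 1) \<sigma> (dsum 1 id \<tau>)). c + 1 \<le> d} =
      (+) (c + 1) ` triple_cuts (Suc k) (dsum 1 id \<tau>)"
    by (rule triple_cuts_dsum)
  then show ?thesis
    unfolding dsum_fixed_point[OF assms(1)] by (simp add: card_image inj_on_def Suc_le_eq)
qed

text \<open>
Prepending a fixed point shifts the triples of $\tau$ and adds at most the triple $0, 1, 2$, whose
third cut is the cut $1$ of $\tau$. The condition $1 \le k$ excludes the empty $\tau$, for which
\<open>is_cut \<tau> 1\<close> holds although $1 \oplus \tau$ has no second entry.
\<close>
lemma card_triple_cuts_fixed_point:
  assumes "\<tau> \<in> Sn k"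
  shows "card (triple_cuts (Suc k) (dsum 1 id \<tau>)) =
         card (triple_cuts k \<tau>) + (if 1 \<le> k \<and> is_cut \<tau> 1 then 1 else 0)"
proof -
  let ?T = "triple_cuts (Suc k) (dsum 1 id \<tau>)"
  have "?T = {d \<in> ?T. 1 \<le> d} \<union> (if 0 \<in> ?T then {0} else {})" (is "_ = ?A \<union> ?B")
    by (auto simp: Suc_le_eq intro: gr0I)
  moreover have "card ?A = card (triple_cuts k \<tau>)"
    using triple_cuts_dsum[of id 1 \<tau> k] assms by (simp add: card_image)
  moreover have "0 \<in> ?T \<longleftrightarrow> 1 \<le> k \<and> is_cut \<tau> 1"
    using dsum_cut_shift[of id 1 \<tau> k 1] dsum_cut_shift[of id 1 \<tau> k 0] assms
    by (auto simp: triple_cuts_def is_cut_def dsum_def numeral_2_eq_2)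
  moreover have "card (?A \<union> ?B) = card ?A + card ?B"
    by (intro card_Un_disjoint) auto
  ultimately show ?thesis by simp
qed

section \<open>Recurrences for the weighted sums\<close>

text \<open>
The geometric sum $1 + q + \dots + q^{m-1}$, with its exponents distributed over the elements of a
set of size $m$: each element receives the number of larger elements.
\<close>
lemma power_card_minus_one:
  fixes q :: "'a :: comm_ring_1" and S :: "'b :: linorder set"
  assumes "finite S"
  shows "q ^ card S - 1 = (q - 1) * (\<Sum>c\<in>S. q ^ card {d \<in> S. c < d})"
  using assms
proof (induction S rule: finite_linorder_min_induct)
  case (insert b A)
  have "b \<notin> A" using insert by auto
  moreover have "{d \<in> insert b A. b < d} = A" using insert by auto
  moreover have "{d \<in> insert b A. c < d} = {d \<in> A. c < d}" if "c \<in> A" for c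
    using insert that by auto
  ultimately have "(q - 1) * (\<Sum>c\<in>insert b A. q ^ card {d \<in> insert b A. c < d}) =
      (q - 1) * q ^ card A + (q ^ card A - 1)"
    using insert by (simp add: distrib_left del: insert_iff cong: sum.cong)
  also have "\<dots> = q ^ card (insert b A) - 1"
    using insert \<open>b \<notin> A\<close> by (simp add: algebra_simps)
  finally show ?case by simp
qed simp

definition weight_sum :: "'a :: comm_ring_1 \<Rightarrow> nat \<Rightarrow> 'a" where
  "weight_sum q n = (\<Sum>\<pi>\<in>Sn n. q ^ card (triple_cuts n \<pi>))"

definition fixed_point_weight_sum :: "'a :: comm_ring_1 \<Rightarrow> nat \<Rightarrow> 'a" where
  "fixed_point_weight_sum q k =
     (\<Sum>\<tau>\<in>Sn k. q ^ card (triple_cuts (Suc k) (dsum 1 id \<tau>)))"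

text \<open>
Each occurrence of each permutation is marked in turn, and the sum is rearranged by the cut $c$ at
which the marked occurrence starts. The $c!$ choices of $\sigma$ all contribute equally.
\<close>
lemma weight_sum_rec:
  "weight_sum q (n + 2) - fact (n + 2) =
     (q - 1) * (\<Sum>c\<le>n. fact c * fixed_point_weight_sum q (n - c))"
proof -
  let ?T = "triple_cuts (n + 2)"
  have *: "(\<Sum>\<pi> \<in> {\<pi>. \<pi> \<in> Sn (n + 2) \<and> c \<in> ?T \<pi>}. q ^ card {d \<in> ?T \<pi>. c < d}) =
      fact c * fixed_point_weight_sum q (n - c)" if "c \<le> n" for c
  proof -
    define k where "k = n - c"
    have n: "n + 2 = c + 2 + k" using that by (simp add: k_def)
    have "(\<Sum>\<pi> \<in> {\<pi>. \<pi> \<in> Sn (n + 2) \<and> c \<in> ?T \<pi>}. q ^ card {d \<in> ?T \<pi>. c < d}) =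
        (\<Sum>x\<in>Sn c \<times> Sn k. q ^ card {d \<in> ?T (case x of (\<sigma>, \<tau>) \<Rightarrow> dsum (c + 2) \<sigma> \<tau>). c < d})"
      unfolding n by (rule sum.reindex_bij_betw[OF triple_cut_bij, symmetric])
    also have "\<dots> = (\<Sum>x\<in>Sn c \<times> Sn k. q ^ card (triple_cuts (Suc k) (dsum 1 id (snd x))))"
      unfolding n
      by (intro sum.cong refl)
        (auto simp: card_later_triple_cuts[unfolded One_nat_def] simp del: add_2_eq_Suc')
    also have "\<dots> = (\<Sum>\<sigma>\<in>Sn c. fixed_point_weight_sum q k)"
      by (simp add: fixed_point_weight_sum_def sum.cartesian_product case_prod_unfold
          del: sum_constant)
    finally show ?thesis by (simp add: k_def)
  qed
  have "weight_sum q (n + 2) - fact (n + 2) = (\<Sum>\<pi>\<in>Sn (n + 2). q ^ card (?T \<pi>) - 1)"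
    by (simp add: weight_sum_def sum_subtractf del: fact_Suc add_2_eq_Suc')
  also have "\<dots> = (q - 1) * (\<Sum>\<pi>\<in>Sn (n + 2). \<Sum>c\<in>?T \<pi>. q ^ card {d \<in> ?T \<pi>. c < d})"
    by (simp only: power_card_minus_one[OF finite_triple_cuts] sum_distrib_left)
  also have "(\<Sum>\<pi>\<in>Sn (n + 2). \<Sum>c\<in>?T \<pi>. q ^ card {d \<in> ?T \<pi>. c < d}) =
      (\<Sum>\<pi>\<in>Sn (n + 2). \<Sum>c\<in>{c. c \<in> {..n} \<and> c \<in> ?T \<pi>}. q ^ card {d \<in> ?T \<pi>. c < d})"
    by (intro sum.cong refl) (auto simp: triple_cuts_def)
  also have "\<dots> = (\<Sum>c\<le>n. \<Sum>\<pi> \<in> {\<pi>. \<pi> \<in> Sn (n + 2) \<and> c \<in> ?T \<pi>}. q ^ card {d \<in> ?T \<pi>. c < d})"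
    by (rule sum.swap_restrict) auto
  also have "\<dots> = (\<Sum>c\<le>n. fact c * fixed_point_weight_sum q (n - c))"
    by (intro sum.cong refl *) auto
  finally show ?thesis .
qed

lemma weight_sum_small: "n < 2 \<Longrightarrow> weight_sum q n = fact n"
  by (simp add: weight_sum_def triple_cuts_def)

lemma fixed_point_weight_sum_0: "fixed_point_weight_sum q 0 = weight_sum q 0"
  by (simp add: fixed_point_weight_sum_def weight_sum_def triple_cuts_def)

text \<open>
The permutations that begin with $1$ are the ones that gain an occurrence, so their weight changes
from $w$ to $q w = w + (q-1) w$. Removing their first entry produces the sum for $k$ again.
\<close>
lemma fixed_point_weight_sum_Suc:
  "fixed_point_weight_sum q (Suc k) =
     weight_sum q (Suc k) + (q - 1) * fixed_point_weight_sum q k"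
proof -
  let ?w = "\<lambda>\<tau>. q ^ card (triple_cuts (Suc k) \<tau>)"
  have id: "Sn 1 = {id}"
    by (simp add: Sn_def permutes_sing)
  have "fixed_point_weight_sum q (Suc k) =
      (\<Sum>\<tau>\<in>Sn (Suc k). ?w \<tau> + (if is_cut \<tau> 1 then (q - 1) * ?w \<tau> else 0))"
    unfolding fixed_point_weight_sum_def
    by (intro sum.cong refl) (simp add: card_triple_cuts_fixed_point[unfolded One_nat_def] algebra_simps)
  also have "\<dots> = weight_sum q (Suc k) + (q - 1) * (\<Sum>\<tau>\<in>{\<tau> \<in> Sn (1 + k). is_cut \<tau> 1}. ?w \<tau>)"
    by (auto simp: sum.distrib weight_sum_def sum.inter_filter sum_distrib_left intro!: sum.cong)
  also have "(\<Sum>\<tau>\<in>{\<tau> \<in> Sn (1 + k). is_cut \<tau> 1}. ?w \<tau>) =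
      (\<Sum>x\<in>Sn 1 \<times> Sn k. ?w (case x of (\<sigma>, \<tau>) \<Rightarrow> dsum 1 \<sigma> \<tau>))"
    by (rule sum.reindex_bij_betw[OF dsum_bij, symmetric])
  also have "\<dots> = fixed_point_weight_sum q k"
    unfolding id fixed_point_weight_sum_def
    by (rule sum.reindex_bij_witness[of _ "Pair id" snd]) auto
  finally show ?thesis .
qed

section \<open>Generating functions\<close>

lemma fact_gf_nth [simp]: "fact_gf $ n = fact n"
  by (simp add: fact_gf_def)

text \<open>
Multiplying the first equation by $1 - u x$ allows $(1 - u x) w = p$ to be substituted.
\<close>
lemma eliminate_fixed_point_gf:
  fixes p f u x w :: "'a :: comm_ring_1"
  assumes "p - f = u * (x^2 * (f * w))" "w = p + u * (x * w)"
  shows "p * (1 - u * x - u * x^2 * f) = (1 - u * x) * f"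
proof -
  have "p = w - u * (x * w)"
    using assms(2)[symmetric] by (simp only: eq_diff_eq)
  then have w: "(1 - u * x) * w = p"
    by (simp add: left_diff_distrib mult.assoc)
  have "p * (1 - u * x - u * x^2 * f) - (1 - u * x) * f =
      (1 - u * x) * (p - f) - u * x^2 * f * p"
    by (simp add: algebra_simps)
  also have "\<dots> = u * x^2 * f * ((1 - u * x) * w) - u * x^2 * f * p"
    by (simp only: assms(1) mult_ac)
  finally show ?thesis by (simp add: w)
qed

lemma weight_gf:
  fixes q :: "'a :: {comm_ring_1, ring_char_0}"
  defines "P \<equiv> Abs_fps (weight_sum q)"
  shows "P * (1 + (1 - fps_const q) * fps_X + (1 - fps_const q) * fps_X^2 * fact_gf) =
         (1 + fps_X - fps_const q * fps_X) * fact_gf"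
proof -
  define Q where "Q = Abs_fps (fixed_point_weight_sum q)"
  define u where "u = fps_const (q - 1)"
  have 1: "P - fact_gf = u * (fps_X^2 * (fact_gf * Q))"
  proof (rule fps_ext)
    fix n
    show "(P - fact_gf) $ n = (u * (fps_X^2 * (fact_gf * Q))) $ n"
    proof (cases "n < 2")
      case True
      then show ?thesis by (simp add: P_def u_def weight_sum_small fps_X_power_mult_nth)
    next
      case False
      then obtain m where n: "n = m + 2" using le_Suc_ex[of 2 n] by (auto simp: add.commute)
      have "(u * (fps_X^2 * (fact_gf * Q))) $ n = (q - 1) * (fact_gf * Q) $ m"
        by (simp add: n u_def fps_X_power_mult_nth)
      also have "\<dots> = (P - fact_gf) $ n"
        using weight_sum_rec[of q m] unfolding n P_def Q_def
        by (simp add: fps_mult_nth atLeast0AtMost del: fact_Suc add_2_eq_Suc')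
      finally show ?thesis by simp
    qed
  qed
  have 2: "Q = P + u * (fps_X * Q)"
  proof (rule fps_ext)
    fix n show "Q $ n = (P + u * (fps_X * Q)) $ n"
      by (cases n) (simp_all add: P_def Q_def u_def fixed_point_weight_sum_0 fixed_point_weight_sum_Suc)
  qed
  have q: "fps_const q = 1 + u"
    by (simp add: u_def fps_const_sub[symmetric] del: fps_const_sub)
  show ?thesis
    using eliminate_fixed_point_gf[OF 1 2] unfolding q by (simp add: algebra_simps)
qed

lemma weight_gf_quotient:
  fixes q :: "'a :: {field, ring_char_0}"
  shows "Abs_fps (weight_sum q) = ((1 + fps_X - fps_const q * fps_X) * fact_gf) /
    (1 + (1 - fps_const q) * fps_X + (1 - fps_const q) * fps_X^2 * fact_gf)"
    (is "?P = ?N / ?D")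
proof -
  have "?D $ 0 = 1" by (simp add: power2_eq_square)
  then have "?D \<noteq> 0" by (metis fps_zero_nth zero_neq_one)
  moreover have "?P * ?D = ?N" by (rule weight_gf)
  ultimately show ?thesis by (metis nonzero_mult_div_cancel_right)
qed

theorem theorem3p5:
  shows "avoid_gf shaded =
           ((1 + fps_X) * fact_gf) / (1 + fps_X + fps_X^2 * fact_gf)
       \<and> distr_gf shaded =
           ((1 + fps_X - fps_q * fps_X) * fact_gf) /
           (1 + (1 - fps_q) * fps_X + (1 - fps_q) * fps_X^2 * fact_gf)"
proof
  \<comment> \<open>Since \<open>0 ^ 0 = 1\<close>, the weights at \<open>q = 0\<close> count the avoiding permutations.\<close>
  have "card (Sn_avoid shaded n) = (\<Sum>\<pi>\<in>Sn n. if mesh12_count shaded n \<pi> = 0 then 1 else 0)" for n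
    by (simp add: Sn_avoid_def sum.If_cases Int_def)
  then have "of_nat (card (Sn_avoid shaded n)) = weight_sum (0 :: rat) n" for n
    by (simp add: weight_sum_def mesh12_count_shaded power_0_left if_distrib[of of_nat] cong: sum.cong if_cong)
  then have "avoid_gf shaded = Abs_fps (weight_sum 0)"
    by (simp add: avoid_gf_def)
  then show "avoid_gf shaded = ((1 + fps_X) * fact_gf) / (1 + fps_X + fps_X^2 * fact_gf)"
    using weight_gf_quotient[of "0 :: rat"] by simp
  define q where "q = of_qpoly (monom 1 1)"
  have to_fract: "of_qpoly = to_fract"
    by (simp add: fun_eq_iff of_qpoly_def to_fract_def)
  have "to_fract (x ^ n) = to_fract x ^ n" for x :: "int poly" and n
    by (induction n) simp_all
  then have "of_qpoly (monom 1 n) = q ^ n" for n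
    unfolding q_def to_fract by (metis monom_power mult_1 power_one)
  then have "of_qpoly (mesh12_poly shaded n) = weight_sum q n" for n
    unfolding mesh12_poly_def weight_sum_def to_fract
    by (simp add: mesh12_count_shaded cong: sum.cong)
  then have "distr_gf shaded = Abs_fps (weight_sum q)"
    by (simp add: distr_gf_def)
  moreover have "fps_q = fps_const q"
    by (simp add: fps_q_def q_def)
  ultimately show "distr_gf shaded =
      ((1 + fps_X - fps_q * fps_X) * fact_gf) /
      (1 + (1 - fps_q) * fps_X + (1 - fps_q) * fps_X^2 * fact_gf)"
    by (simp only: weight_gf_quotient)
qed

end
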